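(* For any $\tau\in\mathbb{C}$ with $\Re(\tau)>-1$, the linear functional $\mathscr{G}_{H}(\tau)$ has the following integral representation: $$\langle \mathscr{G}_{H}(\tau),p\rangle=\frac{1}{\sqrt{\pi}\,\Gamma(\tau+1)}\int_{-\infty}^{\infty}p(x)\,|x|^{\tau}H_\tau(|x|)\,e^{-x^2}\,dx\qquad\text{for all } p\in\mathbb{P},$$ where $H_\tau$ is the Hermite function of degree $\tau$.
   Context: $\mathbb{P}$ is the vector space of polynomials in one variable with complex coefficients, $\mathbb{P}'$ its (algebraic) dual, and $\langle u,p\rangle$ denotes the action of $u\in\mathbb{P}'$ on $p\in\mathbb{P}$. The Pochhammer symbol is $(a)_0=1$, $(a)_k=a(a+1)\cdots(a+k-1)$ for $k\ge1$. The generalized Hermite linear functional $\mathscr{G}_{H}(\tau)\in\mathbb{P}'$ of index $\tau\in\mathbb{C}$, $\tau\neq -1,-2,-3,\dots$, is the linear functional with moments $$\langle \mathscr{G}_{H}(\tau),x^{2k}\rangle=\frac{(\tau+1)_{2k}}{k!\,2^{2k}},\qquad \langle \mathscr{G}_{H}(\tau),x^{2k+1}\rangle=0,\qquad k=0,1,2,\dots$$ The Hermite function of degree $\tau\in\mathbb{C}$ is $$H_\tau(x)=2^\tau\frac{\Gamma(\frac12)}{\Gamma(\frac{1-\tau}{2})}\,{}_1F_1\left(-\frac{\tau}{2};\frac12;x^2\right)+2^{\tau}x\,\frac{\Gamma(-\frac12)}{\Gamma(-\frac{\tau}{2})}\,{}_1F_1\left(\frac{1-\tau}{2};\frac32;x^2\right),$$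 where ${}_1F_1(a;b;z)=\sum_{k\ge0}\frac{(a)_k}{(b)_k}\frac{z^k}{k!}$ and $1/\Gamma$ is taken to be $0$ at the poles of $\Gamma$. *)

theory Defs
  imports "HOL-Analysis.Analysis" "HOL-Computational_Algebra.Polynomial"
begin

(* The n-th moment: n = 2k gives (tau+1)_{2k} / (k! 2^{2k}), odd n gives 0. *)
definition gen_hermite_moment :: "complex \<Rightarrow> nat \<Rightarrow> complex" where
  "gen_hermite_moment \<tau> n =
     (if even n then pochhammer (\<tau> + 1) n / (fact (n div 2) * 2 ^ n) else 0)"

(* A linear functional on complex polynomials is determined by its moments; this is the
   linear extension of the moment sequence, see gen_hermite_functional_unique below.
   The moments make sense for every tau; the usual index restriction tau <> -1, -2, ...
   is left to the theorems that use the functional. *)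
definition gen_hermite_functional :: "complex \<Rightarrow> complex poly \<Rightarrow> complex" where
  "gen_hermite_functional \<tau> p = (\<Sum>n\<le>degree p. coeff p n * gen_hermite_moment \<tau> n)"

definition hyp1F1 :: "complex \<Rightarrow> complex \<Rightarrow> complex \<Rightarrow> complex" where
  "hyp1F1 a b z = (\<Sum>k. pochhammer a k / pochhammer b k * (z ^ k / fact k))"

(* rGamma is the entire function 1/Gamma, equal to 0 at the poles of Gamma
   (whereas 1 / Gamma z is 0 there only through the convention Gamma z = 0, 1 / 0 = 0). *)
definition hermite_fun :: "complex \<Rightarrow> complex \<Rightarrow> complex" where
  "hermite_fun \<tau> x =
     2 powr \<tau> * (Gamma (1/2) * rGamma ((1 - \<tau>) / 2)) * hyp1F1 (- \<tau> / 2) (1/2) (x\<^sup>2) +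
     2 powr \<tau> * x * (Gamma (- 1/2) * rGamma (- \<tau> / 2)) * hyp1F1 ((1 - \<tau>) / 2) (3/2) (x\<^sup>2)"

lemma gen_hermite_functional_altdef:
  assumes "degree p \<le> N"
  shows "gen_hermite_functional \<tau> p = (\<Sum>n\<le>N. coeff p n * gen_hermite_moment \<tau> n)"
  unfolding gen_hermite_functional_def
  by (rule sum.mono_neutral_left) (use assms in \<open>auto simp: coeff_eq_0\<close>)

lemma vector_space_smult: "vector_space (smult :: complex \<Rightarrow> complex poly \<Rightarrow> complex poly)"
  by unfold_locales (auto simp: smult_add_right smult_add_left)

lemma vector_space_times: "vector_space ((*) :: complex \<Rightarrow> complex \<Rightarrow> complex)"
  by unfold_locales (auto simp: algebra_simps)

lemma linear_gen_hermite_functional: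
  "Vector_Spaces.linear smult (*) (gen_hermite_functional \<tau>)"
proof -
  have "gen_hermite_functional \<tau> (p + q) =
          gen_hermite_functional \<tau> p + gen_hermite_functional \<tau> q" for p q
  proof -
    let ?N = "max (degree p) (degree q)"
    show ?thesis
      using gen_hermite_functional_altdef[of "p + q" ?N \<tau>]
        gen_hermite_functional_altdef[of p ?N \<tau>] gen_hermite_functional_altdef[of q ?N \<tau>]
      by (simp add: degree_add_le_max distrib_right sum.distrib)
  qed
  moreover have "gen_hermite_functional \<tau> (smult c p) = c * gen_hermite_functional \<tau> p" for c p
    using gen_hermite_functional_altdef[of "smult c p" "degree p" \<tau>]
      gen_hermite_functional_altdef[of p "degree p" \<tau>]
    by (simp add: degree_smult_le sum_distrib_left mult.assoc)
  ultimately show ?thesis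
    using vector_space_smult vector_space_times
    by (simp add: Vector_Spaces.linear_iff)
qed

lemma gen_hermite_functional_monom:
  "gen_hermite_functional \<tau> (monom 1 n) = gen_hermite_moment \<tau> n"
proof -
  have "(\<Sum>i\<le>n. coeff (monom 1 n :: complex poly) i * gen_hermite_moment \<tau> i) =
        (\<Sum>i\<in>{n}. gen_hermite_moment \<tau> i)"
    by (rule sum.mono_neutral_cong_right) auto
  thus ?thesis by (simp add: gen_hermite_functional_altdef[of _ n] degree_monom_le)
qed

lemma gen_hermite_functional_moments:
  "gen_hermite_functional \<tau> (monom 1 (2 * k)) = pochhammer (\<tau> + 1) (2 * k) / (fact k * 2 ^ (2 * k))"
  "gen_hermite_functional \<tau> (monom 1 (2 * k + 1)) = 0"
  by (simp_all add: gen_hermite_functional_monom gen_hermite_moment_def)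

lemma gen_hermite_functional_unique:
  assumes lin: "Vector_Spaces.linear smult (*) u"
    and even: "\<And>k. u (monom 1 (2 * k)) = pochhammer (\<tau> + 1) (2 * k) / (fact k * 2 ^ (2 * k))"
    and odd: "\<And>k. u (monom 1 (2 * k + 1)) = 0"
  shows "u = gen_hermite_functional \<tau>"
proof
  fix p :: "complex poly"
  interpret Vector_Spaces.linear smult "(*)" u by (rule lin)
  have mom: "u (monom 1 n) = gen_hermite_moment \<tau> n" for n
    by (cases "even n") (auto elim!: evenE oddE simp: gen_hermite_moment_def even odd[simplified])
  have "u p = u (\<Sum>n\<le>degree p. smult (coeff p n) (monom 1 n))"
    by (simp add: smult_monom poly_as_sum_of_monoms)
  also have "\<dots> = gen_hermite_functional \<tau> p"
    by (simp only: sum scale mom gen_hermite_functional_def)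
  finally show "u p = gen_hermite_functional \<tau> p" .
qed

end

theory Submission
  imports Defs
begin

text \<open>
  Each monomial reduces to the Mellin transform, for $\Re s > 0$,
  $$\int_0^\infty x^{s-1} H_\tau(x) e^{-x^2}\,dx =
    \sqrt\pi\, 2^{\tau-s}\, \Gamma(s) / \Gamma\bigl(\frac{s-\tau+1}{2}\bigr)$$
  at $s = \tau + n + 1$. For $\Re\tau < 0$ this follows by Fubini from
  $\Gamma(-\tau) H_\tau(x) = \int_0^\infty t^{-\tau-1} e^{-t^2-2xt}\,dt$, because
  $e^{-x^2} e^{-t^2-2xt}$ depends only on $x + t$. The recurrence
  $H_{\tau+1} = 2x H_\tau - 2\tau H_{\tau-1}$ then extends it strip by strip to all $\tau$,
  so no asymptotics of $H_\tau$ at infinity are needed.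
\<close>

subsection \<open>Contiguous relations\<close>

lemma hyp1F1_summable:
  fixes a b z :: complex
  assumes b: "b \<notin> \<int>\<^sub>\<le>\<^sub>0"
  shows "summable (\<lambda>k. pochhammer a k / pochhammer b k * (z ^ k / fact k))"
proof -
  let ?f = "\<lambda>k. pochhammer a k / pochhammer b k * (z ^ k / fact k)"
  \<comment> \<open>The ratio of consecutive terms is (a + k) / (b + k) * z / (k + 1). Exchanging
    the denominators gives one factor tending to 1 and one tending to 0.\<close>
  let ?r = "\<lambda>k. (1 + (a - 1) / (1 + of_nat k)) * (z / (b + of_nat k))"
  have "(\<lambda>k. c / (d + of_nat k)) \<longlonglongrightarrow> 0" for c d :: complex
    by (intro tendsto_divide_0[OF tendsto_const] tendsto_add_filterlim_at_infinity[OF tendsto_const]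
          tendsto_of_nat)
  then have "?r \<longlonglongrightarrow> (1 + 0) * 0"
    by (intro tendsto_mult tendsto_add tendsto_const)
  then have "(\<lambda>k. norm (?r k)) \<longlonglongrightarrow> 0"
    by (simp add: tendsto_norm_zero)
  then have "\<forall>\<^sub>F k in sequentially. norm (?r k) < 1/2"
    by (rule order_tendstoD) simp
  then obtain N where N: "norm (?r k) < 1/2" if "k \<ge> N" for k
    by (auto simp: eventually_sequentially)
  have step: "?f (Suc k) = ?r k * ?f k" for k
  proof -
    have "b + of_nat k \<noteq> 0"
      using b by (metis add.commute eq_neg_iff_add_eq_0 minus_of_nat_in_nonpos_Ints add_eq_0_iff)
    moreover have "(1 + of_nat k :: complex) \<noteq> 0"
      by (metis of_nat_Suc of_nat_neq_0)
    moreover have "pochhammer b k \<noteq> 0"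
      using b pochhammer_eq_0_imp_nonpos_Int by blast
    ultimately show ?thesis
      by (simp add: pochhammer_rec' divide_simps)
  qed
  show ?thesis
  proof (rule summable_ratio_test[of "1/2" N])
    show "norm (?f (Suc k)) \<le> 1/2 * norm (?f k)" if "k \<ge> N" for k
      unfolding step norm_mult[of "?r k"] using N[OF that] by (intro mult_right_mono) auto
  qed simp
qed

lemma hyp1F1_sums:
  assumes "b \<notin> \<int>\<^sub>\<le>\<^sub>0"
  shows "(\<lambda>k. pochhammer a k / pochhammer b k * (z ^ k / fact k)) sums hyp1F1 a b z"
  unfolding hyp1F1_def by (intro summable_sums hyp1F1_summable assms)

text \<open>The coefficients satisfy (a - 1)_{k+1} - (a)_{k+1} = -(k + 1) (a)_k. The factor k + 1
  cancels against (k + 1)!, and (b)_{k+1} = b (b + 1)_k, so the difference of the two series is a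
  multiple of a third one, shifted by one index.\<close>

lemma hyp1F1_contiguous_lower:
  assumes b: "b \<notin> \<int>\<^sub>\<le>\<^sub>0"
  shows "hyp1F1 (a - 1) b z = hyp1F1 a b z - z / b * hyp1F1 a (b + 1) z"
proof -
  let ?t = "\<lambda>a b k. pochhammer a k / pochhammer b k * (z ^ k / fact k)"
  have b1: "b + 1 \<notin> \<int>\<^sub>\<le>\<^sub>0"
    using b plus_one_in_nonpos_Ints_imp by blast
  have "?t (a - 1) b (Suc k) - ?t a b (Suc k) = - (z / b) * ?t a (b + 1) k" for k
  proof -
    have "pochhammer (a - 1) (Suc k) - pochhammer a (Suc k) = - (1 + of_nat k) * pochhammer a k"
      using pochhammer_rec[of "a - 1" k] pochhammer_rec'[of a k] by (simp add: algebra_simps)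
    moreover have "pochhammer (b + 1) k \<noteq> 0" "b \<noteq> 0" "(1 + of_nat k :: complex) \<noteq> 0"
      using b b1 pochhammer_eq_0_imp_nonpos_Int by (blast, force, metis of_nat_Suc of_nat_neq_0)
    ultimately show ?thesis
      unfolding left_diff_distrib[symmetric] diff_divide_distrib[symmetric] pochhammer_rec[of b k]
      by (simp add: divide_simps) (simp add: algebra_simps)
  qed
  then have "(\<lambda>k. ?t (a - 1) b (Suc k) - ?t a b (Suc k)) sums (- (z / b) * hyp1F1 a (b + 1) z)"
    by (simp only: sums_mult[OF hyp1F1_sums[OF b1]])
  \<comment> \<open>Both series start with 1, so prepending the term of index 0 does not change the
    sum.\<close>
  then have "(\<lambda>k. ?t (a - 1) b k - ?t a b k) sums (- (z / b) * hyp1F1 a (b + 1) z)"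
    by (subst (asm) sums_Suc_iff) simp
  moreover have "(\<lambda>k. ?t (a - 1) b k - ?t a b k) sums (hyp1F1 (a - 1) b z - hyp1F1 a b z)"
    by (intro sums_diff hyp1F1_sums b)
  ultimately have "- (z / b) * hyp1F1 a (b + 1) z = hyp1F1 (a - 1) b z - hyp1F1 a b z"
    by (rule sums_unique2)
  then show ?thesis
    by (simp add: algebra_simps)
qed

text \<open>Holds term by term: over the common denominator (b + 1)_k the right-hand side has the
  factor (b + k) - (a + k), which is b - a for every k.\<close>

lemma hyp1F1_contiguous_mixed:
  assumes b: "b \<notin> \<int>\<^sub>\<le>\<^sub>0"
  shows "(b - a) * hyp1F1 a (b + 1) z = b * hyp1F1 a b z - a * hyp1F1 (a + 1) (b + 1) z"
proof -
  let ?t = "\<lambda>a b k. pochhammer a k / pochhammer b k * (z ^ k / fact k)"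
  have b1: "b + 1 \<notin> \<int>\<^sub>\<le>\<^sub>0"
    using b plus_one_in_nonpos_Ints_imp by blast
  have "(b - a) * ?t a (b + 1) k = b * ?t a b k - a * ?t (a + 1) (b + 1) k" for k
  proof -
    have "pochhammer (b + 1) k \<noteq> 0" "pochhammer b k \<noteq> 0"
      using b b1 pochhammer_eq_0_imp_nonpos_Int by blast+
    moreover have "(b + of_nat k) * pochhammer b k = b * pochhammer (b + 1) k"
      using pochhammer_rec[of b k] pochhammer_rec'[of b k] by simp
    ultimately have b': "b / pochhammer b k = (b + of_nat k) / pochhammer (b + 1) k"
      by (metis frac_eq_eq)
    have a': "a * pochhammer (a + 1) k = (a + of_nat k) * pochhammer a k"
      using pochhammer_rec[of a k] pochhammer_rec'[of a k] by simp
    have "b * (pochhammer a k / pochhammer b k) - a * (pochhammer (a + 1) k / pochhammer (b + 1) k)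
        = pochhammer a k * (b / pochhammer b k) - (a * pochhammer (a + 1) k) / pochhammer (b + 1) k"
      by simp
    also have "\<dots> = (b - a) * (pochhammer a k / pochhammer (b + 1) k)"
      unfolding a' b' by (simp add: diff_divide_distrib[symmetric]) (simp add: algebra_simps)
    finally have "(b - a) * (pochhammer a k / pochhammer (b + 1) k) =
       b * (pochhammer a k / pochhammer b k) - a * (pochhammer (a + 1) k / pochhammer (b + 1) k)"
      by simp
    then show ?thesis
      by (simp only: left_diff_distrib mult.assoc[symmetric])
  qed
  then have "(\<lambda>k. (b - a) * ?t a (b + 1) k) sums
      (b * hyp1F1 a b z - a * hyp1F1 (a + 1) (b + 1) z)"
    using sums_diff[OF sums_mult[OF hyp1F1_sums[OF b]] sums_mult[OF hyp1F1_sums[OF b1]]] by simp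
  moreover have "(\<lambda>k. (b - a) * ?t a (b + 1) k) sums ((b - a) * hyp1F1 a (b + 1) z)"
    by (intro sums_mult hyp1F1_sums b1)
  ultimately show ?thesis
    using sums_unique2 by blast
qed

section \<open>The three-term recurrence in the degree\<close>

lemma Re_pos_notin_nonpos_Ints: "Re z > 0 \<Longrightarrow> z \<notin> \<int>\<^sub>\<le>\<^sub>0"
  by (auto elim!: nonpos_Ints_cases)

lemma half_notin_nonpos_Ints: "(1/2 :: complex) \<notin> \<int>\<^sub>\<le>\<^sub>0"
  by (rule Re_pos_notin_nonpos_Ints) simp

lemma Gamma_minus_half_complex: "Gamma (- 1/2 :: complex) = - 2 * of_real (sqrt pi)"
proof -
  have "(- 1/2 :: complex) \<notin> \<int>\<^sub>\<le>\<^sub>0"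
  proof
    assume "(- 1/2 :: complex) \<in> \<int>\<^sub>\<le>\<^sub>0"
    then obtain n where "(- 1/2 :: complex) = of_int n"
      by (rule nonpos_Ints_cases)
    then have "- 1/2 = real_of_int n"
      by (auto dest: arg_cong[of _ _ Re])
    then have "2 * n = - 1"
      by linarith
    then show False
      by presburger
  qed
  from Gamma_plus1[OF this] show ?thesis
    by (simp add: Gamma_one_half_complex)
qed

text \<open>Multiplication by x swaps the parts even and odd in x. The functional equation of
  \<open>rGamma\<close> leaves only the factors \<open>G\<close> and \<open>K\<close>: comparing the
  coefficients of \<open>G\<close> (even part) is the relation \<open>c1\<close>, those of
  \<open>K\<close> (odd part) the relation \<open>c2\<close>. Since \<open>rGamma\<close> is entire,
  no degree is exceptional.\<close>

theorem hermite_fun_recurrence: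
  "hermite_fun (\<tau> + 1) x = 2 * x * hermite_fun \<tau> x - 2 * \<tau> * hermite_fun (\<tau> - 1) x"
proof -
  define z where "z = x\<^sup>2"
  define G where "G = rGamma (1 - \<tau> / 2)"
  define K where "K = rGamma ((1 - \<tau>) / 2)"
  define w where "w = (2 powr \<tau> :: complex)"
  define E where "E = hyp1F1 (- \<tau> / 2) (1/2) z"
  define F where "F = hyp1F1 ((1 - \<tau>) / 2) (3/2) z"
  have c1: "hyp1F1 (- (\<tau> + 1) / 2) (1/2) z = hyp1F1 ((1 - \<tau>) / 2) (1/2) z - 2 * z * F"
    using hyp1F1_contiguous_lower[OF half_notin_nonpos_Ints, of "(1 - \<tau>) / 2" z]
    by (simp add: F_def field_simps)
  have c2: "(\<tau> + 1) * hyp1F1 (- \<tau> / 2) (3/2) z = E + \<tau> * hyp1F1 (1 - \<tau> / 2) (3/2) z"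
  proof -
    have b: "1/2 - - \<tau> / 2 = (\<tau> + 1) / 2" "1/2 + 1 = (3/2 :: complex)" "- \<tau> / 2 + 1 = 1 - \<tau> / 2"
      by (simp_all add: field_simps)
    from hyp1F1_contiguous_mixed[OF half_notin_nonpos_Ints, of "- \<tau> / 2" z]
    have "2 * ((\<tau> + 1) / 2 * hyp1F1 (- \<tau> / 2) (3/2) z) =
        2 * (1 / 2 * E - - \<tau> / 2 * hyp1F1 (1 - \<tau> / 2) (3/2) z)"
      unfolding b E_def by (rule arg_cong)
    then show ?thesis
      by simp
  qed
  have g1: "rGamma (- \<tau> / 2) = - \<tau> / 2 * G"
    using rGamma_plus1[of "- \<tau> / 2"] by (simp add: G_def algebra_simps)
  have g2: "rGamma (- (\<tau> + 1) / 2) = - (\<tau> + 1) / 2 * K"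
    using rGamma_plus1[of "- (\<tau> + 1) / 2"] by (simp add: K_def field_simps)
  have w: "(2 powr (\<tau> + 1) :: complex) = 2 * w" "(2 powr (\<tau> - 1) :: complex) = w / 2"
    by (simp_all add: w_def powr_add powr_diff)
  have a: "(1 - (\<tau> + 1)) / 2 = - \<tau> / 2" "(1 - (\<tau> - 1)) / 2 = 1 - \<tau> / 2"
    "- (\<tau> - 1) / 2 = (1 - \<tau>) / 2"
    by (simp_all add: field_simps)
  let ?s = "complex_of_real (sqrt pi)"
  have h1: "hermite_fun (\<tau> + 1) x = 2 * w * ?s * (- \<tau> / 2 * G) * (hyp1F1 ((1 - \<tau>) / 2) (1/2) z - 2 * z * F)
      + 2 * w * ?s * x * K * ((\<tau> + 1) * hyp1F1 (- \<tau> / 2) (3/2) z)"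
    unfolding hermite_fun_def a w g1 g2 Gamma_one_half_complex Gamma_minus_half_complex
      z_def[symmetric] c1 by (simp add: field_simps)
  have h2: "hermite_fun \<tau> x = w * ?s * K * E + w * x * ?s * \<tau> * G * F"
    unfolding hermite_fun_def g1 Gamma_one_half_complex Gamma_minus_half_complex
      z_def[symmetric] E_def F_def K_def w_def by (simp add: field_simps)
  have h3: "hermite_fun (\<tau> - 1) x = w / 2 * ?s * G * hyp1F1 ((1 - \<tau>) / 2) (1/2) z
      - w * x * ?s * K * hyp1F1 (1 - \<tau> / 2) (3/2) z"
    unfolding hermite_fun_def a w Gamma_one_half_complex Gamma_minus_half_complex
      z_def[symmetric] G_def K_def by (simp add: field_simps)
  show ?thesis
    unfolding h1 h2 h3 c2 by (simp add: algebra_simps z_def power2_eq_square)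
qed

subsection \<open>Gamma, Gaussian and Beta integrals with complex exponents\<close>

text \<open>Extending the power by zero turns half-line integrals into integrals over the whole
  line, so that translations, scalings and Fubini apply without tracking domains.\<close>

definition pos_powr :: "complex \<Rightarrow> real \<Rightarrow> complex" where
  "pos_powr s x = (if x > 0 then of_real x powr s else 0)"

lemma pos_powr_measurable [measurable]: "pos_powr s \<in> borel_measurable borel"
proof -
  have "pos_powr s = (\<lambda>x. if x > 0 then exp (s * of_real (ln x)) else 0)"
    by (auto simp: pos_powr_def powr_def Ln_of_real)
  moreover have "\<dots> \<in> borel_measurable borel"
    by measurable
  ultimately show ?thesis
    by simp
qed

lemma norm_pos_powr: "norm (pos_powr s x) = (if x > 0 then x powr Re s else 0)"
  by (auto simp: pos_powr_def norm_powr_real_powr)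

lemma pos_powr_mult: "c > 0 \<Longrightarrow> pos_powr s (c * x) = pos_powr s c * pos_powr s x"
  by (auto simp: pos_powr_def zero_less_mult_iff powr_times_real)

lemma pos_powr_add: "pos_powr (s + t) x = pos_powr s x * pos_powr t x"
  by (auto simp: pos_powr_def powr_add)

lemma pos_powr_add_of_nat: "pos_powr (s + of_nat n) x = pos_powr s x * of_real x ^ n"
  by (auto simp: pos_powr_def powr_add powr_nat)

text \<open>A bridge from gauge integrals over a set to Bochner integrals over
  \<open>lborel\<close>. Borel measurability of \<open>g\<close> permits the descent from the
  completed measure \<open>lebesgue\<close>.\<close>

lemma has_bochner_integral_lborelI:
  fixes f g :: "'a::euclidean_space \<Rightarrow> 'b::euclidean_space"
  assumes "f absolutely_integrable_on S" "integral S f = b"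
    and g: "\<And>x. g x = indicator S x *\<^sub>R f x" and [measurable]: "g \<in> borel_measurable borel"
  shows "has_bochner_integral lborel g b"
proof -
  have "(\<lambda>x. indicator S x *\<^sub>R f x) = g"
    using g by auto
  then have "integrable lebesgue g" "integral\<^sup>L lebesgue g = b"
    using assms set_lebesgue_integral_eq_integral(2)[OF assms(1)]
    by (simp_all add: set_integrable_def set_lebesgue_integral_def)
  then show ?thesis
    by (simp add: has_bochner_integral_iff integrable_completion integral_completion)
qed

lemma has_bochner_integral_Gamma:
  assumes "Re s > 0"
  shows "has_bochner_integral lborel (\<lambda>t. pos_powr (s - 1) t * of_real (exp (- t))) (Gamma s)"
proof (rule has_bochner_integral_lborelI)
  show "(\<lambda>t. of_real t powr (s - 1) / of_real (exp t)) absolutely_integrable_on {0<..}"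
    by (rule absolutely_integrable_Gamma_integral'[OF assms])
  show "integral {0<..} (\<lambda>t. of_real t powr (s - 1) / of_real (exp t)) = Gamma s"
    by (rule integral_unique[OF Gamma_integral_complex'[OF assms]])
  show "pos_powr (s - 1) t * of_real (exp (- t)) =
      indicator {0<..} t *\<^sub>R (of_real t powr (s - 1) / of_real (exp t))" for t
    by (auto simp: pos_powr_def exp_minus field_simps)
qed measurable

text \<open>Substitute t = x^2 in Euler's integral for Gamma (s / 2). The Jacobian 2x raises the
  power x^(s-2) to x^(s-1), and its factor 2 accounts for the final division by 2.\<close>

lemma has_bochner_integral_Gaussian_Gamma:
  assumes "Re s > 0"
  shows "has_bochner_integral lborel (\<lambda>t. pos_powr (s - 1) t * of_real (exp (- t\<^sup>2))) (Gamma (s / 2) / 2)"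
proof -
  let ?f = "\<lambda>t. complex_of_real t powr (s / 2 - 1) / of_real (exp t)"
  have s2: "Re (s / 2) > 0"
    using assms by simp
  have im: "(\<lambda>x::real. x\<^sup>2) ` {0<..} = {0<..}"
  proof safe
    fix y :: real assume "y > 0"
    then show "y \<in> (\<lambda>x. x\<^sup>2) ` {0<..}"
      by (intro image_eqI[of _ _ "sqrt y"]) auto
  qed auto
  have "(\<lambda>x. \<bar>2 * x\<bar> *\<^sub>R ?f (x\<^sup>2)) absolutely_integrable_on {0<..} \<and>
      integral {0<..} (\<lambda>x. \<bar>2 * x\<bar> *\<^sub>R ?f (x\<^sup>2)) = Gamma (s / 2) \<longleftrightarrow>
      ?f absolutely_integrable_on (\<lambda>x::real. x\<^sup>2) ` {0<..} \<and>
      integral ((\<lambda>x::real. x\<^sup>2) ` {0<..}) ?f = Gamma (s / 2)"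
    by (intro has_absolute_integral_change_of_variables_real)
       (auto intro!: derivative_eq_intros inj_onI simp: power2_eq_iff)
  then have *: "(\<lambda>x. \<bar>2 * x\<bar> *\<^sub>R ?f (x\<^sup>2)) absolutely_integrable_on {0<..}"
    "integral {0<..} (\<lambda>x. \<bar>2 * x\<bar> *\<^sub>R ?f (x\<^sup>2)) = Gamma (s / 2)"
    using absolutely_integrable_Gamma_integral'[OF s2] integral_unique[OF Gamma_integral_complex'[OF s2]]
    unfolding im by auto
  have "2 * (pos_powr (s - 1) x * of_real (exp (- x\<^sup>2))) = indicator {0<..} x *\<^sub>R (\<bar>2 * x\<bar> *\<^sub>R ?f (x\<^sup>2))" for x
  proof (cases "x > 0")
    case True
    have "complex_of_real x powr (s - 1) = x * (complex_of_real (x * x) powr (s / 2 - 1))"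
      using True by (simp add: powr_times_real powr_add[symmetric] powr_diff)
    with True show ?thesis
      by (simp add: pos_powr_def exp_minus field_simps power2_eq_square scaleR_conv_of_real)
  qed (auto simp: pos_powr_def)
  then have "has_bochner_integral lborel (\<lambda>x. 2 * (pos_powr (s - 1) x * of_real (exp (- x\<^sup>2)))) (Gamma (s / 2))"
    by (rule has_bochner_integral_lborelI[OF *]) measurable
  from has_bochner_integral_mult_right[OF this, of "1/2"] show ?thesis
    by simp
qed

section \<open>Double integrals of functions of x + t, and the Beta integral\<close>

text \<open>For positive x and t the decay of \<open>h\<close> gives the majorant e^(-x) e^(-t) up
  to a constant, so the integrand is dominated by a product of two Gamma integrands. Elsewhere it
  vanishes.\<close>

lemma integrable_pair_pos_powr:
  fixes h :: "real \<Rightarrow> complex"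
  assumes s: "Re s > 0" and a: "Re a > 0" and [measurable]: "h \<in> borel_measurable borel"
    and h: "\<And>r. r > 0 \<Longrightarrow> norm (h r) \<le> C * exp (- r)"
  shows "integrable (lborel \<Otimes>\<^sub>M lborel) (\<lambda>(x, t). pos_powr (s - 1) x * (pos_powr (a - 1) t * h (x + t)))"
proof (rule Bochner_Integration.integrable_bound)
  let ?F = "\<lambda>s t. pos_powr (s - 1) t * of_real (exp (- t))"
  have F: "integrable lborel (?F s)" if "Re s > 0" for s
    using has_bochner_integral_Gamma[OF that] by (simp add: has_bochner_integral_iff)
  show "integrable (lborel \<Otimes>\<^sub>M lborel) (\<lambda>(x, t). C * (?F s x * ?F a t))"
  proof (rule lborel_pair.Fubini_integrable)
    show "integrable lborel (\<lambda>x. \<integral>y. norm (case (x, y) of (x, t) \<Rightarrow> C * (?F s x * ?F a t)) \<partial>lborel)"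
      using integrable_norm[OF F[OF s]] by (simp add: norm_mult)
    show "AE x in lborel. integrable lborel (\<lambda>y. case (x, y) of (x, t) \<Rightarrow> C * (?F s x * ?F a t))"
      using F[OF a] by simp
  qed measurable
  show "AE p in lborel \<Otimes>\<^sub>M lborel. norm (case p of (x, t) \<Rightarrow> pos_powr (s - 1) x * (pos_powr (a - 1) t * h (x + t)))
      \<le> norm (case p of (x, t) \<Rightarrow> C * (?F s x * ?F a t))"
  proof (intro AE_I2, safe)
    fix x t :: real
    show "norm (pos_powr (s - 1) x * (pos_powr (a - 1) t * h (x + t))) \<le> norm (C * (?F s x * ?F a t))"
    proof (cases "x > 0 \<and> t > 0")
      case True
      then have "norm (h (x + t)) \<le> \<bar>C\<bar> * (exp (- x) * exp (- t))"
        using h[of "x + t"] by (simp add: exp_add[symmetric] abs_le_iff order_trans[OF _ mult_right_mono[OF abs_ge_self]])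
      then have "norm (pos_powr (s - 1) x) * (norm (pos_powr (a - 1) t) * norm (h (x + t))) \<le>
          norm (pos_powr (s - 1) x) * (norm (pos_powr (a - 1) t) * (\<bar>C\<bar> * (exp (- x) * exp (- t))))"
        by (intro mult_left_mono norm_ge_zero)
      then show ?thesis
        by (simp add: norm_mult mult_ac)
    qed (auto simp: pos_powr_def)
  qed
qed measurable

text \<open>
  The constant is the Beta integral, but its value is not needed here: taking
  $h(r) = e^{-r}$ in this identity determines it afterwards.
\<close>
lemma pos_powr_convolution:
  fixes h :: "real \<Rightarrow> complex"
  assumes s: "Re s > 0" and a: "Re a > 0" and [measurable]: "h \<in> borel_measurable borel"
    and h: "\<And>r. r > 0 \<Longrightarrow> norm (h r) \<le> C * exp (- r)"
  shows "(\<integral>x. \<integral>t. pos_powr (s - 1) x * (pos_powr (a - 1) t * h (x + t)) \<partial>lborel \<partial>lborel) =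
    (\<integral>u. pos_powr (s - 1) u * pos_powr (a - 1) (1 - u) \<partial>lborel) * (\<integral>r. pos_powr (s + a - 1) r * h r \<partial>lborel)"
proof -
  let ?f = "\<lambda>x t. pos_powr (s - 1) x * (pos_powr (a - 1) t * h (x + t))"
  let ?g = "\<lambda>x r. pos_powr (s - 1) x * (pos_powr (a - 1) (r - x) * h r)"
  let ?B = "\<integral>u. pos_powr (s - 1) u * pos_powr (a - 1) (1 - u) \<partial>lborel"
  have f: "integrable (lborel \<Otimes>\<^sub>M lborel) (\<lambda>(x, t). ?f x t)"
    by (rule integrable_pair_pos_powr) fact+
  \<comment> \<open>The substitution r = x + t for fixed x. It is only ever applied to
    one-dimensional slices, also when integrability on the plane is carried over from
    \<open>?f\<close> to \<open>?g\<close>: corresponding slices have the same integral of the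
    norm.\<close>
  have shift: "?g x (x + 1 * t) = ?f x t" for x t
    by simp
  have g: "integrable (lborel \<Otimes>\<^sub>M lborel) (\<lambda>(x, r). ?g x r)"
  proof (rule lborel_pair.Fubini_integrable)
    have "(\<integral>r. norm (?g x r) \<partial>lborel) = (\<integral>t. norm (?f x t) \<partial>lborel)" for x
      by (subst lborel_integral_real_affine[of 1 _ x]) simp_all
    then show "integrable lborel (\<lambda>x. \<integral>y. norm (case (x, y) of (x, r) \<Rightarrow> ?g x r) \<partial>lborel)"
      using lborel_pair.integrable_fst[of "\<lambda>x t. norm (?f x t)"] integrable_norm[OF f]
      by (simp add: case_prod_beta')
    have "integrable lborel (?g x) \<longleftrightarrow> integrable lborel (?f x)" for x
      using lborel_integrable_real_affine_iff[of 1 "?g x" x] by simp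
    then show "AE x in lborel. integrable lborel (\<lambda>y. case (x, y) of (x, r) \<Rightarrow> ?g x r)"
      using lborel_pair.AE_integrable_fst[OF f] by simp
  qed measurable
  have inner: "(\<integral>x. ?g x r \<partial>lborel) = ?B * (pos_powr (s + a - 1) r * h r)" for r
  proof (cases "r > 0")
    case True
    \<comment> \<open>Scaling x = r u separates the variables: the two powers contribute r^(s-1)
      r^(a-1) and the Jacobian one more r, while the remaining u-integral does not depend on
      r.\<close>
    have "(\<integral>x. ?g x r \<partial>lborel) = r *\<^sub>R (\<integral>u. ?g (0 + r * u) r \<partial>lborel)"
      using True by (subst lborel_integral_real_affine[of r _ 0]) simp_all
    also have "(\<lambda>u. ?g (0 + r * u) r) =
        (\<lambda>u. (pos_powr (s - 1) u * pos_powr (a - 1) (1 - u)) * (pos_powr (s - 1 + (a - 1)) r * h r))"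
    proof
      fix u
      have "r - r * u = r * (1 - u)"
        by (simp add: algebra_simps)
      then show "?g (0 + r * u) r =
          (pos_powr (s - 1) u * pos_powr (a - 1) (1 - u)) * (pos_powr (s - 1 + (a - 1)) r * h r)"
        using True by (simp only: add_0 pos_powr_mult pos_powr_add mult_ac)
    qed
    also have "(\<integral>u. (pos_powr (s - 1) u * pos_powr (a - 1) (1 - u)) * (pos_powr (s - 1 + (a - 1)) r * h r) \<partial>lborel)
        = ?B * (pos_powr (s - 1 + (a - 1)) r * h r)"
      by simp
    also have "r *\<^sub>R (?B * (pos_powr (s - 1 + (a - 1)) r * h r)) =
        ?B * (pos_powr (s - 1 + (a - 1) + of_nat 1) r * h r)"
      unfolding pos_powr_add_of_nat by (simp add: scaleR_conv_of_real)
    finally show ?thesis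
      by (simp add: algebra_simps)
  next
    case False
    \<comment> \<open>For r at most 0, x and r - x cannot both be positive.\<close>
    then have "?g x r = 0" for x
      by (auto simp: pos_powr_def)
    then have "(\<integral>x. ?g x r \<partial>lborel) = 0"
      by (simp only: Bochner_Integration.integral_zero)
    with False show ?thesis
      by (simp add: pos_powr_def)
  qed
  have "(\<integral>x. \<integral>t. ?f x t \<partial>lborel \<partial>lborel) = (\<integral>x. \<integral>r. ?g x r \<partial>lborel \<partial>lborel)"
  proof (rule Bochner_Integration.integral_cong[OF refl])
    show "(\<integral>t. ?f x t \<partial>lborel) = (\<integral>r. ?g x r \<partial>lborel)" for x
      using lborel_integral_real_affine[of 1 "?g x" x] by (simp only: shift) simp
  qed
  also have "\<dots> = (\<integral>r. \<integral>x. ?g x r \<partial>lborel \<partial>lborel)"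
    by (rule lborel_pair.Fubini_integral[OF g, symmetric])
  also have "\<dots> = ?B * (\<integral>r. pos_powr (s + a - 1) r * h r \<partial>lborel)"
    unfolding inner by simp
  finally show ?thesis .
qed

text \<open>For the exponential \<open>?h\<close> the double integral of
  \<open>pos_powr_convolution\<close> factors into two Gamma integrals, and the single integral is a
  third one, which is nonzero.\<close>

lemma Beta_integral_complex:
  assumes s: "Re s > 0" and a: "Re a > 0"
  shows "(\<integral>u. pos_powr (s - 1) u * pos_powr (a - 1) (1 - u) \<partial>lborel) = Gamma s * Gamma a / Gamma (s + a)"
proof -
  let ?h = "\<lambda>r. complex_of_real (exp (- r))"
  have I: "(\<integral>t. pos_powr (s - 1) t * ?h t \<partial>lborel) = Gamma s" if "Re s > 0" for s
    using has_bochner_integral_Gamma[OF that] by (simp add: has_bochner_integral_iff)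
  have "pos_powr (s - 1) x * (pos_powr (a - 1) t * ?h (x + t)) =
      (pos_powr (s - 1) x * ?h x) * (pos_powr (a - 1) t * ?h t)" for x t
    by (simp add: exp_diff mult_ac exp_minus divide_simps)
  then have "(\<integral>x. \<integral>t. pos_powr (s - 1) x * (pos_powr (a - 1) t * ?h (x + t)) \<partial>lborel \<partial>lborel) = Gamma s * Gamma a"
    by (simp only: integral_mult_right_zero integral_mult_left_zero I[OF s] I[OF a])
  moreover have "(\<integral>x. \<integral>t. pos_powr (s - 1) x * (pos_powr (a - 1) t * ?h (x + t)) \<partial>lborel \<partial>lborel) =
    (\<integral>u. pos_powr (s - 1) u * pos_powr (a - 1) (1 - u) \<partial>lborel) * (\<integral>r. pos_powr (s + a - 1) r * ?h r \<partial>lborel)"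
    by (rule pos_powr_convolution[where C = 1]) (use s a in auto)
  moreover have "(\<integral>r. pos_powr (s + a - 1) r * ?h r \<partial>lborel) = Gamma (s + a)"
    using s a by (intro I) simp
  moreover have "Gamma (s + a) \<noteq> 0"
    using s a by (simp add: Gamma_eq_zero_iff Re_pos_notin_nonpos_Ints)
  ultimately show ?thesis
    by (metis nonzero_mult_div_cancel_right)
qed

text \<open>Legendre's duplication formula at w / 2. It serves twice: with w =
  \<open>- \<tau>\<close> it matches the normalisation of the Hermite function, with w =
  \<open>s - \<tau>\<close> it simplifies the constant of the Mellin transform.\<close>

lemma Gamma_half_divide_Gamma:
  assumes "Re w > 0"
  shows "Gamma (w / 2) / (2 * Gamma w) = of_real (sqrt pi) * 2 powr (- w) * rGamma ((w + 1) / 2)"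
proof -
  have "exp ((1 - w) * of_real (ln 2)) = 2 * (2 powr (- w) :: complex)"
    using Ln_of_real[of 2]
    by (simp add: powr_def left_diff_distrib exp_diff exp_minus exp_of_real field_simps)
  moreover have "Gamma (w / 2) * Gamma (w / 2 + 1/2) =
      exp ((1 - w) * of_real (ln 2)) * of_real (sqrt pi) * Gamma w"
    using Gamma_legendre_duplication[of "w / 2"] assms by (simp add: Re_pos_notin_nonpos_Ints)
  moreover have "w / 2 + 1/2 = (w + 1) / 2"
    by (simp add: add_divide_distrib)
  moreover have "Gamma w \<noteq> 0" "Gamma ((w + 1) / 2) \<noteq> 0"
    using assms by (simp_all add: Gamma_eq_zero_iff Re_pos_notin_nonpos_Ints)
  ultimately show ?thesis
    by (simp add: rGamma_inverse_Gamma divide_simps)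
qed

subsection \<open>The Mellin transform of the Hermite function\<close>

lemma sums_even_odd:
  fixes f :: "nat \<Rightarrow> 'a::real_normed_vector"
  assumes "(\<lambda>n. f (2 * n)) sums a" "(\<lambda>n. f (2 * n + 1)) sums b"
  shows "f sums (a + b)"
proof -
  have "(\<lambda>n. if even n then f n else 0) sums a"
    using assms(1) by (subst sums_mono_reindex[symmetric, of "\<lambda>n. 2 * n"])
      (auto simp: strict_mono_def elim!: evenE)
  moreover have "(\<lambda>n. if even n then 0 else f n) sums b"
    using assms(2) by (subst sums_mono_reindex[symmetric, of "\<lambda>n. 2 * n + 1"])
      (auto simp: strict_mono_def elim!: oddE)
  ultimately have "(\<lambda>n. (if even n then f n else 0) + (if even n then 0 else f n)) sums (a + b)"
    by (rule sums_add)
  also have "(\<lambda>n. (if even n then f n else 0) + (if even n then 0 else f n)) = f"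
    by auto
  finally show ?thesis .
qed

text \<open>This is the series obtained by expanding e^(-2xt) in the Laplace integral: each
  coefficient contains a Gaussian moment. Terms of even and odd index form the two confluent series
  of \<open>hermite_fun\<close>.\<close>

lemma hermite_fun_sums:
  assumes "Re \<tau> < 0"
  shows "(\<lambda>n. (- 2 * x) ^ n / fact n * (Gamma ((of_nat n - \<tau>) / 2) / 2)) sums
    (Gamma (- \<tau>) * hermite_fun \<tau> x)"
proof -
  let ?a = "\<lambda>n. (- 2 * x) ^ n / fact n * (Gamma ((of_nat n - \<tau>) / 2) / 2)"
  let ?t = "\<lambda>a b k. pochhammer a k / pochhammer b k * ((x\<^sup>2) ^ k / fact k)"
  have ni: "- \<tau> / 2 \<notin> \<int>\<^sub>\<le>\<^sub>0" "(1 - \<tau>) / 2 \<notin> \<int>\<^sub>\<le>\<^sub>0" "- \<tau> \<notin> \<int>\<^sub>\<le>\<^sub>0" "(3/2 :: complex) \<notin> \<int>\<^sub>\<le>\<^sub>0"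
    using assms by (auto intro!: Re_pos_notin_nonpos_Ints)
  have p: "Gamma (z + of_nat k) = pochhammer z k * Gamma z" if "z \<notin> \<int>\<^sub>\<le>\<^sub>0" for z :: complex and k
    using pochhammer_Gamma[OF that, of k] that by (simp add: Gamma_eq_zero_iff)
  have poch: "pochhammer (1/2 :: complex) k \<noteq> 0" for k
    using half_notin_nonpos_Ints pochhammer_eq_0_imp_nonpos_Int by blast
  have "?a (2 * k) = Gamma (- \<tau> / 2) / 2 * ?t (- \<tau> / 2) (1/2) k" for k
  proof -
    have e: "(of_nat (2 * k) - \<tau>) / 2 = - \<tau> / 2 + of_nat k"
      by (simp add: field_simps)
    have x: "(- 2 * x) ^ (2 * k) = 2 ^ (2 * k) * (x\<^sup>2) ^ k"
      by (simp add: power_mult power_mult_distrib)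
    show ?thesis
      unfolding e x fact_double[where 'a = complex] p[OF ni(1)] by (simp add: mult_ac)
  qed
  then have even: "(\<lambda>k. ?a (2 * k)) sums (Gamma (- \<tau> / 2) / 2 * hyp1F1 (- \<tau> / 2) (1/2) (x\<^sup>2))"
    by (simp only: sums_mult[OF hyp1F1_sums[OF half_notin_nonpos_Ints]])
  have "?a (2 * k + 1) = - x * Gamma ((1 - \<tau>) / 2) * ?t ((1 - \<tau>) / 2) (3/2) k" for k
  proof -
    have e: "(of_nat (2 * k + 1) - \<tau>) / 2 = (1 - \<tau>) / 2 + of_nat k"
      by (simp add: field_simps)
    have x: "(- 2 * x) ^ (2 * k + 1) = - 2 * x * 2 ^ (2 * k) * (x\<^sup>2) ^ k"
      by (simp add: power_mult power_mult_distrib)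
    \<comment> \<open>From (2k)! = 4^k (1/2)_k k! and (2k + 1) (1/2)_k = (3/2)_k.\<close>
    have f: "fact (2 * k + 1) = (2 ^ (2 * k) * pochhammer (3/2) k * fact k :: complex)"
    proof -
      have "(1/2 + of_nat k) * pochhammer (1/2) k = 1/2 * (pochhammer (3/2) k :: complex)"
        using pochhammer_rec[of "1/2 :: complex" k] pochhammer_rec'[of "1/2 :: complex" k] by simp
      then have "2 * ((1/2 + of_nat k) * pochhammer (1/2) k) = 2 * (1/2 * (pochhammer (3/2) k :: complex))"
        by (rule arg_cong)
      then have q: "(1 + 2 * of_nat k) * pochhammer (1/2) k = (pochhammer (3/2) k :: complex)"
        by (simp add: algebra_simps)
      have d: "fact (2 * k + 1) = (1 + 2 * of_nat k) * (fact (2 * k) :: complex)"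
        by (simp add: algebra_simps)
      show ?thesis
        unfolding d fact_double q[symmetric] by (simp only: mult_ac)
    qed
    show ?thesis
      unfolding e x f p[OF ni(2)] by (simp add: mult_ac)
  qed
  then have "(\<lambda>k. ?a (2 * k + 1)) sums (- x * Gamma ((1 - \<tau>) / 2) * hyp1F1 ((1 - \<tau>) / 2) (3/2) (x\<^sup>2))"
    by (simp only: sums_mult[OF hyp1F1_sums[OF ni(4)]])
  with even have "?a sums (Gamma (- \<tau> / 2) / 2 * hyp1F1 (- \<tau> / 2) (1/2) (x\<^sup>2) +
      - x * Gamma ((1 - \<tau>) / 2) * hyp1F1 ((1 - \<tau>) / 2) (3/2) (x\<^sup>2))"
    by (rule sums_even_odd)
  also have "\<dots> = Gamma (- \<tau>) * hermite_fun \<tau> x"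
  proof -
    have nz: "Gamma (- \<tau>) \<noteq> 0" "Gamma ((1 - \<tau>) / 2) \<noteq> 0" "Gamma (- \<tau> / 2) \<noteq> 0"
      using ni by (simp_all add: Gamma_eq_zero_iff)
    have e: "Gamma (- \<tau> / 2) / 2 =
        Gamma (- \<tau>) * 2 powr \<tau> * of_real (sqrt pi) * rGamma ((1 - \<tau>) / 2)"
      using Gamma_half_divide_Gamma[of "- \<tau>"] assms nz by (simp add: field_simps)
    \<comment> \<open>The same duplication identity as \<open>e\<close>, now solved for the other
      Gamma value. The constant -2 sqrt(pi) is Gamma (-1/2).\<close>
    then have o: "- Gamma ((1 - \<tau>) / 2) =
        Gamma (- \<tau>) * 2 powr \<tau> * (- 2 * of_real (sqrt pi)) * rGamma (- \<tau> / 2)"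
      using nz unfolding rGamma_inverse_Gamma by (simp add: field_simps)
    have "- x * Gamma ((1 - \<tau>) / 2) = x * (- Gamma ((1 - \<tau>) / 2))"
      by simp
    then show ?thesis
      unfolding e o hermite_fun_def Gamma_one_half_complex Gamma_minus_half_complex
      by (simp only: distrib_left mult_ac)
  qed
  finally show ?thesis .
qed

text \<open>Termwise integration of the exponential series, justified by dominated convergence,
  gives the partial sums in \<open>hermite_fun_sums\<close>.\<close>

theorem hermite_fun_Laplace_integral:
  fixes x :: real
  assumes "Re \<tau> < 0"
  shows "(\<integral>t. pos_powr (- \<tau> - 1) t * of_real (exp (- t\<^sup>2 - 2 * x * t)) \<partial>lborel) =
    Gamma (- \<tau>) * hermite_fun \<tau> (of_real x)"
proof -
  let ?q = "\<lambda>t. pos_powr (- \<tau> - 1) t"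
  let ?s = "\<lambda>N t. \<Sum>n<N. (- 2 * complex_of_real x) ^ n / fact n * (pos_powr (of_nat n - \<tau> - 1) t * of_real (exp (- t\<^sup>2)))"
  \<comment> \<open>The majorant: every partial sum of e^(-2xt) is at most e^(2|x|t) in absolute
    value, and completing the square gives -t^2 + 2|x|t <= (|x| + 1/2)^2 - t. What remains is a
    Gamma integrand.\<close>
  let ?w = "\<lambda>t. exp ((\<bar>x\<bar> + 1/2)\<^sup>2) * norm (?q t * of_real (exp (- t)))"
  have gauss: "has_bochner_integral lborel (\<lambda>t. pos_powr (of_nat n - \<tau> - 1) t * of_real (exp (- t\<^sup>2)))
      (Gamma ((of_nat n - \<tau>) / 2) / 2)" for n
    using assms by (intro has_bochner_integral_Gaussian_Gamma) simp
  have s_eq: "?s N t = ?q t * of_real (exp (- t\<^sup>2)) * of_real (\<Sum>n<N. (- 2 * x * t) ^ n / fact n)" for N t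
  proof -
    have "pos_powr (of_nat n - \<tau> - 1) t = ?q t * of_real t ^ n" for n
      using pos_powr_add_of_nat[of "- \<tau> - 1" n t] by (simp add: algebra_simps)
    moreover have "of_real ((- 2 * x * t) ^ n) = (- 2 * complex_of_real x) ^ n * of_real t ^ n" for n
      by (simp add: power_mult_distrib[symmetric])
    ultimately show ?thesis
      by (simp only: sum_distrib_left of_real_sum of_real_divide of_real_fact times_divide_eq_left
            times_divide_eq_right mult_ac)
  qed
  have "(\<lambda>N. \<integral>t. ?s N t \<partial>lborel) \<longlonglongrightarrow>
      (\<integral>t. ?q t * of_real (exp (- t\<^sup>2 - 2 * x * t)) \<partial>lborel)"
  proof (rule integral_dominated_convergence[where w = ?w])
    show "integrable lborel ?w"
      using has_bochner_integral_Gamma[of "- \<tau>"] assms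
      by (intro integrable_mult_right integrable_norm) (simp add: has_bochner_integral_iff)
    have "(\<lambda>N. ?s N t) \<longlonglongrightarrow> ?q t * of_real (exp (- t\<^sup>2 - 2 * x * t))" for t
    proof -
      have "(\<lambda>n. (- 2 * x * t) ^ n / fact n) sums exp (- 2 * x * t)"
        using exp_converges[of "- 2 * x * t"] by (simp add: divide_inverse mult_ac)
      then have "(\<lambda>N. ?s N t) \<longlonglongrightarrow> ?q t * of_real (exp (- t\<^sup>2)) * of_real (exp (- 2 * x * t))"
        unfolding s_eq sums_def by (intro tendsto_intros)
      also have "complex_of_real (exp (- t\<^sup>2 - 2 * x * t)) = of_real (exp (- t\<^sup>2)) * of_real (exp (- 2 * x * t))"
        by (simp only: of_real_mult[symmetric] exp_add[symmetric]) simp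
      then have "?q t * of_real (exp (- t\<^sup>2)) * of_real (exp (- 2 * x * t)) = ?q t * of_real (exp (- t\<^sup>2 - 2 * x * t))"
        by simp
      finally show ?thesis .
    qed
    then show "AE t in lborel. (\<lambda>N. ?s N t) \<longlonglongrightarrow> ?q t * of_real (exp (- t\<^sup>2 - 2 * x * t))"
      by simp
    have "norm (?s N t) \<le> ?w t" for N t
    proof (cases "t > 0")
      case True
      have "\<bar>\<Sum>n<N. (- 2 * x * t) ^ n / fact n\<bar> \<le> (\<Sum>n<N. (2 * \<bar>x\<bar> * t) ^ n / fact n)"
        using True by (intro order_trans[OF sum_abs] sum_mono) (simp add: power_abs abs_mult)
      also have "\<dots> \<le> exp (2 * \<bar>x\<bar> * t)"
      proof -
        have "(\<lambda>n. (2 * \<bar>x\<bar> * t) ^ n / fact n) sums exp (2 * \<bar>x\<bar> * t)"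
          using exp_converges[of "2 * \<bar>x\<bar> * t"] by (simp add: divide_inverse mult_ac)
        then show ?thesis
          using True by (intro sum_le_suminf[of _ "{..<N}", THEN order_trans]) (auto simp: sums_iff)
      qed
      finally have "exp (- t\<^sup>2) * \<bar>\<Sum>n<N. (- 2 * x * t) ^ n / fact n\<bar> \<le> exp (- t\<^sup>2) * exp (2 * \<bar>x\<bar> * t)"
        by (intro mult_left_mono) auto
      also have "\<dots> \<le> exp ((\<bar>x\<bar> + 1/2)\<^sup>2) * exp (- t)"
        using zero_le_power2[of "t - (\<bar>x\<bar> + 1/2)"]
        by (simp add: exp_add[symmetric] power2_eq_square algebra_simps)
      finally have "norm (?q t) * (exp (- t\<^sup>2) * \<bar>\<Sum>n<N. (- 2 * x * t) ^ n / fact n\<bar>) \<le>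
          norm (?q t) * (exp ((\<bar>x\<bar> + 1/2)\<^sup>2) * exp (- t))"
        by (rule mult_left_mono) simp
      then show ?thesis
        unfolding s_eq norm_mult norm_of_real by (simp add: mult_ac)
    qed (simp add: pos_powr_def)
    then show "AE t in lborel. norm (?s N t) \<le> ?w t" for N
      by simp
  qed measurable
  also have "(\<lambda>N. \<integral>t. ?s N t \<partial>lborel) =
      (\<lambda>N. \<Sum>n<N. (- 2 * of_real x) ^ n / fact n * (Gamma ((of_nat n - \<tau>) / 2) / 2))"
    by (intro ext has_bochner_integral_integral_eq has_bochner_integral_sum has_bochner_integral_mult_right gauss)
  finally show ?thesis
    using hermite_fun_sums[OF assms, of "of_real x"] LIMSEQ_unique unfolding sums_def by blast
qed

text \<open>Apply \<open>pos_powr_convolution\<close> with a = \<open>- \<tau>\<close> and h(r) =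
  e^(-r^2): the inner integral is Gamma(\<open>- \<tau>\<close>) times the wanted integrand, and the
  outcome is a Beta value times a Gaussian moment. Integrability also comes from Fubini.\<close>

lemma mellin_hermite_fun_neg:
  assumes \<tau>: "Re \<tau> < 0" and s: "Re s > 0"
  shows "has_bochner_integral lborel
    (\<lambda>x. pos_powr (s - 1) x * hermite_fun \<tau> (of_real x) * of_real (exp (- x\<^sup>2)))
    (of_real (sqrt pi) * 2 powr (\<tau> - s) * Gamma s * rGamma ((s - \<tau> + 1) / 2))"
proof -
  let ?h = "\<lambda>r. complex_of_real (exp (- r\<^sup>2))"
  let ?f = "\<lambda>x t. pos_powr (s - 1) x * (pos_powr (- \<tau> - 1) t * ?h (x + t))"
  let ?g = "\<lambda>x. pos_powr (s - 1) x * hermite_fun \<tau> (of_real x) * of_real (exp (- x\<^sup>2))"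
  have a: "Re (- \<tau>) > 0" and sa: "Re (s - \<tau>) > 0"
    using \<tau> s by simp_all
  have nz: "Gamma (- \<tau>) \<noteq> 0" "Gamma (s - \<tau>) \<noteq> 0"
    using a sa by (simp_all add: Gamma_eq_zero_iff Re_pos_notin_nonpos_Ints)
  \<comment> \<open>The constant e^(1/4) comes from (r - 1/2)^2 >= 0.\<close>
  have h: "norm (?h r) \<le> exp (1/4) * exp (- r)" for r
    using zero_le_power2[of "r - 1/2"] by (simp add: exp_add[symmetric] power2_eq_square algebra_simps)
  have h': "?h \<in> borel_measurable borel"
    by measurable
  have inner: "(\<integral>t. ?f x t \<partial>lborel) = Gamma (- \<tau>) * ?g x" for x
  proof -
    have "?f x t = pos_powr (s - 1) x * ?h x * (pos_powr (- \<tau> - 1) t * of_real (exp (- t\<^sup>2 - 2 * x * t)))" for t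
    proof -
      have "?h (x + t) = ?h x * of_real (exp (- t\<^sup>2 - 2 * x * t))"
        by (simp only: of_real_mult[symmetric] exp_add[symmetric]) (simp add: power2_eq_square algebra_simps)
      then show ?thesis
        by (simp only: mult_ac)
    qed
    then have "(\<integral>t. ?f x t \<partial>lborel) = pos_powr (s - 1) x * ?h x *
        (\<integral>t. pos_powr (- \<tau> - 1) t * of_real (exp (- t\<^sup>2 - 2 * x * t)) \<partial>lborel)"
      by (simp only: integral_mult_right_zero)
    then show ?thesis
      unfolding hermite_fun_Laplace_integral[OF \<tau>] by (simp only: mult_ac)
  qed
  have "integrable lborel (\<lambda>x. \<integral>t. ?f x t \<partial>lborel)"
    by (rule lborel_pair.integrable_fst[OF integrable_pair_pos_powr[OF s a h' h]])
  then have "integrable lborel (\<lambda>x. inverse (Gamma (- \<tau>)) * (Gamma (- \<tau>) * ?g x))"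
    unfolding inner by (rule integrable_mult_right)
  then have int: "integrable lborel ?g"
    by (simp only: mult.assoc[symmetric] left_inverse[OF nz(1)] mult_1_left)
  have "Gamma (- \<tau>) * integral\<^sup>L lborel ?g = (\<integral>x. \<integral>t. ?f x t \<partial>lborel \<partial>lborel)"
    unfolding inner by simp
  also have "\<dots> = Gamma s * Gamma (- \<tau>) / Gamma (s - \<tau>) * (Gamma ((s - \<tau>) / 2) / 2)"
    using pos_powr_convolution[OF s a h' h] Beta_integral_complex[OF s a]
      has_bochner_integral_integral_eq[OF has_bochner_integral_Gaussian_Gamma[OF sa]] by simp
  also have "\<dots> = Gamma (- \<tau>) * (Gamma s * (Gamma ((s - \<tau>) / 2) / (2 * Gamma (s - \<tau>))))"
    by (simp add: mult_ac)
  finally have "integral\<^sup>L lborel ?g = Gamma s * (Gamma ((s - \<tau>) / 2) / (2 * Gamma (s - \<tau>)))"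
    by (rule mult_left_cancel[OF nz(1), THEN iffD1])
  also have "\<dots> = of_real (sqrt pi) * 2 powr (\<tau> - s) * Gamma s * rGamma ((s - \<tau> + 1) / 2)"
    unfolding Gamma_half_divide_Gamma[OF sa] by simp
  finally show ?thesis
    using int by (simp add: has_bochner_integral_iff)
qed

theorem mellin_hermite_fun:
  assumes s: "Re s > 0"
  shows "has_bochner_integral lborel
    (\<lambda>x. pos_powr (s - 1) x * hermite_fun \<tau> (of_real x) * of_real (exp (- x\<^sup>2)))
    (of_real (sqrt pi) * 2 powr (\<tau> - s) * Gamma s * rGamma ((s - \<tau> + 1) / 2))"
proof -
  obtain N where "Re \<tau> < real N"
    using reals_Archimedean2 by blast
  then show ?thesis
    using s
  \<comment> \<open>Besides the degree, \<open>s\<close> must vary: the factor x in the recurrence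
    raises it by 1. The degrees \<open>\<tau> - 1\<close> and \<open>\<tau> - 2\<close> both lie
    below the previous bound.\<close>
  proof (induction N arbitrary: \<tau> s)
    case 0
    then show ?case
      by (intro mellin_hermite_fun_neg) auto
  next
    case (Suc N)
    let ?I = "\<lambda>\<tau> s x. pos_powr (s - 1) x * hermite_fun \<tau> (of_real x) * of_real (exp (- x\<^sup>2))"
    let ?M = "\<lambda>\<tau> s. of_real (sqrt pi) * 2 powr (\<tau> - s) * Gamma s * rGamma ((s - \<tau> + 1) / 2)"
    have "has_bochner_integral lborel (?I (\<tau> - 1) (s + 1)) (?M (\<tau> - 1) (s + 1))"
      using Suc.prems by (intro Suc.IH) auto
    moreover have "has_bochner_integral lborel (?I (\<tau> - 2) s) (?M (\<tau> - 2) s)"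
      using Suc.prems by (intro Suc.IH) auto
    ultimately have "has_bochner_integral lborel
        (\<lambda>x. 2 * ?I (\<tau> - 1) (s + 1) x - 2 * (\<tau> - 1) * ?I (\<tau> - 2) s x)
        (2 * ?M (\<tau> - 1) (s + 1) - 2 * (\<tau> - 1) * ?M (\<tau> - 2) s)"
      by (intro has_bochner_integral_diff has_bochner_integral_mult_right)
    also have "(\<lambda>x. 2 * ?I (\<tau> - 1) (s + 1) x - 2 * (\<tau> - 1) * ?I (\<tau> - 2) s x) = ?I \<tau> s"
    proof
      fix x :: real
      have p: "pos_powr (s + 1 - 1) x = pos_powr (s - 1) x * of_real x"
        using pos_powr_add_of_nat[of "s - 1" 1 x] by simp
      have h: "hermite_fun \<tau> (of_real x) =
          2 * of_real x * hermite_fun (\<tau> - 1) (of_real x) - 2 * (\<tau> - 1) * hermite_fun (\<tau> - 2) (of_real x)"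
        using hermite_fun_recurrence[of "\<tau> - 1" "of_real x"] by (simp add: algebra_simps)
      show "2 * ?I (\<tau> - 1) (s + 1) x - 2 * (\<tau> - 1) * ?I (\<tau> - 2) s x = ?I \<tau> s x"
        unfolding p h by (simp add: algebra_simps)
    qed
    \<comment> \<open>The claimed values obey the same recurrence: both terms share a common factor,
      with coefficients 2s and \<open>2 * (\<tau> - 1)\<close>. Their difference
      \<open>2 * (s - \<tau> + 1)\<close> is absorbed by the functional equation of
      \<open>rGamma\<close>.\<close>
    also have "2 * ?M (\<tau> - 1) (s + 1) - 2 * (\<tau> - 1) * ?M (\<tau> - 2) s = ?M \<tau> s"
    proof -
      have g: "Gamma (s + 1) = s * Gamma s"
        using Suc.prems by (intro Gamma_plus1 Re_pos_notin_nonpos_Ints) auto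
      have e: "(s + 1 - (\<tau> - 1) + 1) / 2 = (s - \<tau> + 1) / 2 + 1" "(s - (\<tau> - 2) + 1) / 2 = (s - \<tau> + 1) / 2 + 1"
        by (simp_all add: field_simps)
      have p: "2 powr (\<tau> - 1 - (s + 1)) = (2 powr (\<tau> - s) / 4 :: complex)"
        "2 powr (\<tau> - 2 - s) = (2 powr (\<tau> - s) / 4 :: complex)"
        using powr_diff[of "2 :: complex" "\<tau> - s" 2] by (simp_all add: algebra_simps)
      have r: "rGamma ((s - \<tau> + 1) / 2) = (s - \<tau> + 1) / 2 * rGamma ((s - \<tau> + 1) / 2 + 1)"
        by (simp add: rGamma_plus1)
      show ?thesis
        unfolding g e p by (subst r) (simp add: field_simps)
    qed
    finally show ?case .
  qed
qed

section \<open>Moments of the weight on the real line and the integral representation\<close>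

lemma has_bochner_integral_gen_hermite_moment:
  assumes "Re \<tau> > -1"
  shows "has_bochner_integral lborel
    (\<lambda>x::real. of_real x ^ n * of_real \<bar>x\<bar> powr \<tau> * hermite_fun \<tau> (of_real \<bar>x\<bar>) * of_real (exp (- x\<^sup>2)))
    (of_real (sqrt pi) * Gamma (\<tau> + 1) * gen_hermite_moment \<tau> n)"
proof -
  let ?f = "\<lambda>x::real. of_real x ^ n * of_real \<bar>x\<bar> powr \<tau> * hermite_fun \<tau> (of_real \<bar>x\<bar>) * of_real (exp (- x\<^sup>2))"
  let ?s = "\<tau> + 1 + of_nat n"
  let ?M = "of_real (sqrt pi) * 2 powr (\<tau> - ?s) * Gamma ?s * rGamma ((?s - \<tau> + 1) / 2)"
  \<comment> \<open>At x = 0 both sides vanish, because \<open>0 powr \<tau>\<close> is 0; hence the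
    closed half-line may replace the open one.\<close>
  have "indicator {0..} x *\<^sub>R ?f x =
      pos_powr (?s - 1) x * hermite_fun \<tau> (of_real x) * of_real (exp (- x\<^sup>2))" for x
    using pos_powr_add_of_nat[of \<tau> n x] by (cases "x > 0") (auto simp: pos_powr_def algebra_simps split: split_indicator)
  moreover have "has_bochner_integral lborel
      (\<lambda>x. pos_powr (?s - 1) x * hermite_fun \<tau> (of_real x) * of_real (exp (- x\<^sup>2))) ?M"
    using assms by (intro mellin_hermite_fun) simp
  ultimately have half: "has_bochner_integral lborel (\<lambda>x. indicator {0..} x *\<^sub>R ?f x) ?M"
    by simp
  show ?thesis
  proof (cases "even n")
    case True
    then obtain k where n: "n = 2 * k"
      by (elim evenE)
    have ni: "\<tau> + 1 \<notin> \<int>\<^sub>\<le>\<^sub>0"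
      using assms by (intro Re_pos_notin_nonpos_Ints) simp
    have g: "Gamma ?s = Gamma (\<tau> + 1) * pochhammer (\<tau> + 1) n"
      using pochhammer_Gamma[OF ni, of n] ni by (simp add: Gamma_eq_zero_iff)
    have w: "2 powr (\<tau> - ?s) = 1 / (2 * 2 ^ n :: complex)"
      using powr_nat'[of "2 :: complex" "Suc n"] powr_minus[of "2 :: complex" "of_nat (Suc n)"]
      by (simp add: field_simps)
    have e: "(?s - \<tau> + 1) / 2 = 1 + of_nat k"
      by (simp add: n field_simps)
    have r: "rGamma ((?s - \<tau> + 1) / 2) = 1 / fact k"
      unfolding e by (simp add: rGamma_inverse_Gamma Gamma_fact field_simps)
    \<comment> \<open>Two equal half-lines give the factor 2, which cancels the extra 1/2 in
      2^(-n-1). The reciprocal Gamma value at k + 1 supplies the 1 / k! of the moment.\<close>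
    have "2 *\<^sub>R ?M = of_real (sqrt pi) * Gamma (\<tau> + 1) * gen_hermite_moment \<tau> n"
      using True unfolding g w r by (simp add: gen_hermite_moment_def n scaleR_conv_of_real field_simps)
    moreover have "has_bochner_integral lborel ?f (2 *\<^sub>R ?M)"
      using True by (intro has_bochner_integral_even_function[OF half]) simp
    ultimately show ?thesis
      by simp
  next
    case False
    then have "has_bochner_integral lborel ?f 0"
      by (intro has_bochner_integral_odd_function[OF half]) simp
    with False show ?thesis
      by (simp add: gen_hermite_moment_def)
  qed
qed

text \<open>Follows from the monomial case by linearity, dividing by the nonzero Gamma value.
  Integrability is asserted separately because the Bochner integral of a non-integrable function is
  0 by default.\<close>

theorem theorem3p4:
  fixes \<tau> :: complex and p :: "complex poly"
  assumes "Re \<tau> > -1"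
  shows "integrable lborel (\<lambda>x::real. poly p (of_real x) * of_real \<bar>x\<bar> powr \<tau> *
           hermite_fun \<tau> (of_real \<bar>x\<bar>) * of_real (exp (- x\<^sup>2))) \<and>
         gen_hermite_functional \<tau> p =
           1 / (of_real (sqrt pi) * Gamma (\<tau> + 1)) *
           (LINT x|lborel. poly p (of_real x) * of_real \<bar>x\<bar> powr \<tau> *
             hermite_fun \<tau> (of_real \<bar>x\<bar>) * of_real (exp (- x\<^sup>2)))"
proof -
  let ?c = "of_real (sqrt pi) * Gamma (\<tau> + 1)"
  let ?f = "\<lambda>p (x::real). poly p (of_real x) * of_real \<bar>x\<bar> powr \<tau> *
    hermite_fun \<tau> (of_real \<bar>x\<bar>) * of_real (exp (- x\<^sup>2))"
  have "has_bochner_integral lborel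
      (\<lambda>x. \<Sum>n\<le>degree p. coeff p n * (of_real x ^ n * of_real \<bar>x\<bar> powr \<tau> *
        hermite_fun \<tau> (of_real \<bar>x\<bar>) * of_real (exp (- x\<^sup>2))))
      (\<Sum>n\<le>degree p. coeff p n * (?c * gen_hermite_moment \<tau> n))"
    by (intro has_bochner_integral_sum has_bochner_integral_mult_right
          has_bochner_integral_gen_hermite_moment assms)
  also have "(\<lambda>x::real. \<Sum>n\<le>degree p. coeff p n * (of_real x ^ n * of_real \<bar>x\<bar> powr \<tau> *
        hermite_fun \<tau> (of_real \<bar>x\<bar>) * of_real (exp (- x\<^sup>2)))) = ?f p"
    by (simp add: poly_altdef sum_distrib_right mult.assoc)
  also have "(\<Sum>n\<le>degree p. coeff p n * (?c * gen_hermite_moment \<tau> n)) = ?c * gen_hermite_functional \<tau> p"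
    by (simp add: gen_hermite_functional_def sum_distrib_left mult_ac)
  finally have "has_bochner_integral lborel (?f p) (?c * gen_hermite_functional \<tau> p)" .
  moreover have "?c \<noteq> 0"
    using assms by (simp add: Gamma_eq_zero_iff Re_pos_notin_nonpos_Ints)
  ultimately show ?thesis
    unfolding has_bochner_integral_iff by simp
qed

end
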